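(* Let $X$ be an order continuous Banach lattice and $(E_n)$ a bounded abstract bistochastic filtration on $X$. Then for any $x\in X$, the sequence $(E_nx)$ converges uo- and in norm to the same limit.
   Context: A Banach lattice is order continuous if every order null net is norm null. A filtration $(E_n)_{n\ge1}$ on $X$ is a sequence of positive (linear) projections on $X$ with $E_nE_m=E_mE_n=E_{\min(m,n)}$ for all $m,n\ge1$; it is bounded if $\sup_n\|E_n\|<\infty$. It is abstract bistochastic if there exist a weak unit $x_0>0$ in $X$ (i.e. $x\wedge nx_0\uparrow x$ for all $x\ge0$) and a strictly positive order continuous functional $x_0^*>0$ on $X$ (strictly positive: not vanishing on non-zero positive vectors; order continuous: mapping order null nets to order null nets) such that $E_1x_0=x_0$ and $E_1^*x_0^*=x_0^*$ (i.e. $x_0^*\circ E_1=x_0^*$). A net $(x_\alpha)$ order converges to $x$ ($x_\alpha\xrightarrow{o}x$) if there is a net $(y_\beta)$ (possibly over a different index set) with $y_\beta\downarrow 0$ such that for every $\beta$ there is $\alpha_0$ with $|x_\alpha-x|\le y_\beta$ for all $\alpha\ge\alpha_0$; it uo-converges to $x$ if $|x_\alpha-x|\wedge y\xrightarrow{o}0$ for all $y\in X_+$. *)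

theory Defs
  imports "HOL-Analysis.Analysis" "HOL-Library.Lattice_Algebras" "HOL-Library.Lub_Glb"
begin

section \<open>Banach lattices\<close>

text \<open>
  In \<^class>\<open>lattice_ab_group_add_abs\<close> the modulus is \<open>\<bar>x\<bar> = sup x (- x)\<close>.
\<close>

class banach_lattice = banach + ordered_real_vector + lattice_ab_group_add_abs +
  assumes norm_mono_abs: "\<bar>x\<bar> \<le> \<bar>y\<bar> \<Longrightarrow> norm x \<le> norm y"


section \<open>Nets and order convergence\<close>

text \<open>
  A net is a family \<open>x\<close> on a set \<open>I\<close> directed by a preorder \<open>le\<close>.
\<close>

definition directed_index :: "'i set \<Rightarrow> ('i \<Rightarrow> 'i \<Rightarrow> bool) \<Rightarrow> bool" where
  "directed_index I le \<longleftrightarrow>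
     I \<noteq> {} \<and> reflp_on I le \<and> transp_on I le \<and> (\<forall>a\<in>I. \<forall>b\<in>I. \<exists>c\<in>I. le a c \<and> le b c)"

definition net_eventually :: "'i set \<Rightarrow> ('i \<Rightarrow> 'i \<Rightarrow> bool) \<Rightarrow> ('i \<Rightarrow> bool) \<Rightarrow> bool" where
  "net_eventually I le P \<longleftrightarrow> (\<exists>a0\<in>I. \<forall>a\<in>I. le a0 a \<longrightarrow> P a)"

definition decreases_to_zero ::
    "'j set \<Rightarrow> ('j \<Rightarrow> 'j \<Rightarrow> bool) \<Rightarrow> ('j \<Rightarrow> 'a::lattice_ab_group_add_abs) \<Rightarrow> bool" where
  "decreases_to_zero J le y \<longleftrightarrow>
     directed_index J le \<and> monotone_on J le (\<ge>) y \<and> isGlb UNIV (y ` J) 0"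

text \<open>
  The dominating net may have its own index set. Since HOL cannot quantify over the type of
  indices, that set is drawn from the type of the lattice; lemma \<open>order_converges_toI\<close> below
  shows that dominating nets indexed by arbitrary types give nothing more.
\<close>

definition order_converges_to ::
    "'i set \<Rightarrow> ('i \<Rightarrow> 'i \<Rightarrow> bool) \<Rightarrow> ('i \<Rightarrow> 'a::lattice_ab_group_add_abs) \<Rightarrow> 'a \<Rightarrow> bool" where
  "order_converges_to I le x l \<longleftrightarrow>
     (\<exists>(J :: 'a set) le' y. decreases_to_zero J le' y \<and>
        (\<forall>b\<in>J. net_eventually I le (\<lambda>a. \<bar>x a - l\<bar> \<le> y b)))"

definition uo_converges_to ::
    "'i set \<Rightarrow> ('i \<Rightarrow> 'i \<Rightarrow> bool) \<Rightarrow> ('i \<Rightarrow> 'a::lattice_ab_group_add_abs) \<Rightarrow> 'a \<Rightarrow> bool" where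
  "uo_converges_to I le x l \<longleftrightarrow>
     (\<forall>y\<ge>0. order_converges_to I le (\<lambda>a. inf \<bar>x a - l\<bar> y) 0)"

definition norm_null_net ::
    "'i set \<Rightarrow> ('i \<Rightarrow> 'i \<Rightarrow> bool) \<Rightarrow> ('i \<Rightarrow> 'a::real_normed_vector) \<Rightarrow> bool" where
  "norm_null_net I le x \<longleftrightarrow> (\<forall>e>0. net_eventually I le (\<lambda>a. norm (x a) < e))"

text \<open>
  In the next two definitions, nets are again indexed by subsets of the type of the lattice; lemmas \<open>order_continuous_latticeD\<close> and
  \<open>order_continuous_functionalD\<close> extend both properties to nets with arbitrary index types.
\<close>

definition order_continuous_lattice :: "'a::banach_lattice itself \<Rightarrow> bool" where
  "order_continuous_lattice _ \<longleftrightarrow>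
     (\<forall>(I :: 'a set) le (x :: 'a \<Rightarrow> 'a).
        directed_index I le \<longrightarrow> order_converges_to I le x 0 \<longrightarrow> norm_null_net I le x)"

definition order_continuous_functional :: "('a::banach_lattice \<Rightarrow> real) \<Rightarrow> bool" where
  "order_continuous_functional f \<longleftrightarrow>
     (\<forall>(I :: 'a set) le (x :: 'a \<Rightarrow> 'a).
        directed_index I le \<longrightarrow> order_converges_to I le x 0 \<longrightarrow>
        order_converges_to I le (\<lambda>a. f (x a)) 0)"


lemma order_converges_toI:
  fixes x :: "'i \<Rightarrow> 'a::lattice_ab_group_add_abs" and y :: "'j \<Rightarrow> 'a"
  assumes y: "decreases_to_zero J le' y"
    and dom: "\<And>b. b \<in> J \<Longrightarrow> net_eventually I le (\<lambda>a. \<bar>x a - l\<bar> \<le> y b)"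
  shows "order_converges_to I le x l"
proof -
  have dir: "directed_index J le'" and mono: "monotone_on J le' (\<ge>) y"
    and glb: "isGlb UNIV (y ` J) 0"
    using y by (auto simp: decreases_to_zero_def)
  have "\<exists>c\<in>J. y c \<le> y a \<and> y c \<le> y b" if "a \<in> J" "b \<in> J" for a b
  proof -
    obtain c where "c \<in> J" "le' a c" "le' b c"
      using dir \<open>a \<in> J\<close> \<open>b \<in> J\<close> unfolding directed_index_def by blast
    then show ?thesis
      using mono that unfolding monotone_on_def by blast
  qed
  then have "directed_index (y ` J) (\<ge>)"
    using dir unfolding directed_index_def
    by (auto simp: reflp_on_def transp_on_def)
  then have "decreases_to_zero (y ` J) (\<ge>) id"
    using glb by (auto simp: decreases_to_zero_def monotone_on_def)
  moreover have "\<forall>b\<in>y ` J. net_eventually I le (\<lambda>a. \<bar>x a - l\<bar> \<le> id b)"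
    using dom by auto
  ultimately show ?thesis
    unfolding order_converges_to_def by blast
qed

lemma net_transfer:
  fixes x :: "'i \<Rightarrow> 'a::lattice_ab_group_add_abs"
  assumes conv: "order_converges_to I le x 0"
    and self: "\<And>(J :: 'a set) le' (v :: 'a \<Rightarrow> 'a).
      directed_index J le' \<Longrightarrow> order_converges_to J le' v 0 \<Longrightarrow> net_eventually J le' (\<lambda>b. P (v b))"
  shows "net_eventually I le (\<lambda>a. P (x a))"
proof -
  obtain J :: "'a set" and le' and y where y: "decreases_to_zero J le' y"
    and dom: "\<And>b. b \<in> J \<Longrightarrow> net_eventually I le (\<lambda>a. \<bar>x a - 0\<bar> \<le> y b)"
    using conv unfolding order_converges_to_def by blast
  have dir: "directed_index J le'"
    using y by (simp add: decreases_to_zero_def)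
  \<comment> \<open>a counterexample to \<open>P\<close> below each \<open>y b\<close>, if there is one\<close>
  define v where
    "v b = (if \<exists>z. \<bar>z\<bar> \<le> y b \<and> \<not> P z then SOME z. \<bar>z\<bar> \<le> y b \<and> \<not> P z else 0)" for b
  have y0: "0 \<le> y b" if "b \<in> J" for b
    using y that
    by (auto simp: decreases_to_zero_def isGlb_def greatestP_def isLb_def setge_def)
  have v_bad: "\<bar>v b\<bar> \<le> y b \<and> \<not> P (v b)" if "\<exists>z. \<bar>z\<bar> \<le> y b \<and> \<not> P z" for b
    using someI_ex[OF that] that by (simp add: v_def)
  have v_le: "\<bar>v b\<bar> \<le> y b" if "b \<in> J" for b
    using v_bad[of b] y0[OF that] by (cases "\<exists>z. \<bar>z\<bar> \<le> y b \<and> \<not> P z") (auto simp: v_def)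
  have "net_eventually J le' (\<lambda>c. \<bar>v c - 0\<bar> \<le> y b)" if "b \<in> J" for b
    unfolding net_eventually_def
  proof (intro bexI[OF _ that] ballI impI)
    fix c assume c: "c \<in> J" "le' b c"
    have "y c \<le> y b"
      using y c that by (auto simp: decreases_to_zero_def monotone_on_def)
    then show "\<bar>v c - 0\<bar> \<le> y b"
      using v_le[OF c(1)] by auto
  qed
  then have "order_converges_to J le' v 0"
    by (rule order_converges_toI[OF y])
  then obtain b where b: "b \<in> J" "\<And>c. c \<in> J \<Longrightarrow> le' b c \<Longrightarrow> P (v c)"
    using self[OF dir] unfolding net_eventually_def by blast
  have "P (v b)"
    using b dir by (auto simp: directed_index_def reflp_on_def)
  then have "P z" if "\<bar>z\<bar> \<le> y b" for z
    using v_bad[of b] that by blast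
  then show ?thesis
    using dom[OF b(1)] unfolding net_eventually_def by auto
qed

lemma order_continuous_latticeD:
  fixes x :: "'i \<Rightarrow> 'a::banach_lattice"
  assumes "order_continuous_lattice TYPE('a)" and "order_converges_to I le x 0"
  shows "norm_null_net I le x"
  unfolding norm_null_net_def
proof (intro allI impI)
  fix e :: real assume "0 < e"
  show "net_eventually I le (\<lambda>a. norm (x a) < e)"
    using assms(2)
  proof (rule net_transfer)
    fix J :: "'a set" and le' and v :: "'a \<Rightarrow> 'a"
    assume "directed_index J le'" "order_converges_to J le' v 0"
    then show "net_eventually J le' (\<lambda>b. norm (v b) < e)"
      using assms(1) \<open>0 < e\<close> unfolding order_continuous_lattice_def norm_null_net_def by blast
  qed
qed

lemma order_null_real_iff:
  fixes r :: "'i \<Rightarrow> real"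
  shows "order_converges_to I le r 0 \<longleftrightarrow> norm_null_net I le r"
proof
  assume "order_converges_to I le r 0"
  then obtain J :: "real set" and le' and y where y: "decreases_to_zero J le' y"
    and dom: "\<And>b. b \<in> J \<Longrightarrow> net_eventually I le (\<lambda>a. \<bar>r a - 0\<bar> \<le> y b)"
    unfolding order_converges_to_def by blast
  show "norm_null_net I le r"
    unfolding norm_null_net_def
  proof (intro allI impI)
    fix e :: real assume "0 < e"
    have glb: "isGlb UNIV (y ` J) 0"
      using y by (simp add: decreases_to_zero_def)
    have "\<exists>b\<in>J. y b < e"
    proof (rule ccontr)
      assume "\<not> (\<exists>b\<in>J. y b < e)"
      then have "isLb UNIV (y ` J) e"
        by (auto simp: isLb_def setge_def not_less)
      then show False
        using glb \<open>0 < e\<close> by (auto simp: isGlb_def greatestP_def setle_def)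
    qed
    then obtain b where "b \<in> J" "y b < e" by blast
    then show "net_eventually I le (\<lambda>a. norm (r a) < e)"
      using dom[of b] unfolding net_eventually_def by fastforce
  qed
next
  assume null: "norm_null_net I le r"
  have "isGlb UNIV (id ` {0<..}) (0::real)"
    by (auto simp: isGlb_def greatestP_def isLb_def setge_def setle_def intro: field_le_epsilon)
  moreover have "directed_index {0<..} ((\<ge>) :: real \<Rightarrow> real \<Rightarrow> bool)"
  proof -
    have "\<exists>c\<in>{0<..}. c \<le> a \<and> c \<le> b" if "a \<in> {0<..}" "b \<in> {0<..}" for a b :: real
      using that by (intro bexI[of _ "min a b"]) auto
    moreover have "{0<..} \<noteq> ({} :: real set)"
      by (auto intro: exI[of _ 1])
    ultimately show ?thesis
      by (auto simp: directed_index_def reflp_on_def transp_on_def)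
  qed
  ultimately have "decreases_to_zero {0<..} (\<ge>) (id :: real \<Rightarrow> real)"
    by (auto simp: decreases_to_zero_def monotone_on_def)
  then show "order_converges_to I le r 0"
  proof (rule order_converges_toI)
    fix e :: real assume "e \<in> {0<..}"
    then show "net_eventually I le (\<lambda>a. \<bar>r a - 0\<bar> \<le> id e)"
      using null unfolding norm_null_net_def net_eventually_def by fastforce
  qed
qed

lemma order_continuous_functionalD:
  fixes x :: "'i \<Rightarrow> 'a::banach_lattice"
  assumes "order_continuous_functional f" and "order_converges_to I le x 0"
  shows "order_converges_to I le (\<lambda>a. f (x a)) 0"
  unfolding order_null_real_iff norm_null_net_def
proof (intro allI impI)
  fix e :: real assume "0 < e"
  show "net_eventually I le (\<lambda>a. norm (f (x a)) < e)"
    using assms(2)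
  proof (rule net_transfer)
    fix J :: "'a set" and le' and v :: "'a \<Rightarrow> 'a"
    assume "directed_index J le'" "order_converges_to J le' v 0"
    then have "order_converges_to J le' (\<lambda>b. f (v b)) 0"
      using assms(1) unfolding order_continuous_functional_def by blast
    then show "net_eventually J le' (\<lambda>b. norm (f (v b)) < e)"
      using \<open>0 < e\<close> unfolding order_null_real_iff norm_null_net_def by blast
  qed
qed


section \<open>Filtrations\<close>

definition positive_operator :: "('a::banach_lattice \<Rightarrow> 'b::banach_lattice) \<Rightarrow> bool" where
  "positive_operator T \<longleftrightarrow> linear T \<and> (\<forall>x\<ge>0. 0 \<le> T x)"

text \<open>
  Filtrations are indexed by \<open>n \<ge> 1\<close>; the value at \<open>0\<close> is irrelevant throughout.
\<close>

definition filtration :: "(nat \<Rightarrow> 'a::banach_lattice \<Rightarrow> 'a) \<Rightarrow> bool" where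
  "filtration E \<longleftrightarrow>
     (\<forall>n\<ge>1. positive_operator (E n) \<and> E n \<circ> E n = E n) \<and>
     (\<forall>n\<ge>1. \<forall>m\<ge>1. E n \<circ> E m = E (min m n) \<and> E m \<circ> E n = E (min m n))"

text \<open>
  \<^const>\<open>onorm\<close> is meaningful only for bounded operators, hence the first conjunct.
\<close>

definition bounded_filtration :: "(nat \<Rightarrow> 'a::banach_lattice \<Rightarrow> 'a) \<Rightarrow> bool" where
  "bounded_filtration E \<longleftrightarrow>
     filtration E \<and> (\<forall>n\<ge>1. bounded_linear (E n)) \<and> bdd_above ((\<lambda>n. onorm (E n)) ` {1..})"

definition weak_unit :: "'a::banach_lattice \<Rightarrow> bool" where
  "weak_unit e \<longleftrightarrow> 0 < e \<and>
     (\<forall>x\<ge>0. incseq (\<lambda>n::nat. inf x (real n *\<^sub>R e)) \<and>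
             isLub UNIV (range (\<lambda>n::nat. inf x (real n *\<^sub>R e))) x)"

definition strictly_positive_functional :: "('a::banach_lattice \<Rightarrow> real) \<Rightarrow> bool" where
  "strictly_positive_functional f \<longleftrightarrow>
     linear f \<and> (\<forall>x\<ge>0. 0 \<le> f x) \<and> f \<noteq> (\<lambda>x. 0) \<and> (\<forall>x\<ge>0. x \<noteq> 0 \<longrightarrow> f x \<noteq> 0)"

definition abstract_bistochastic :: "(nat \<Rightarrow> 'a::banach_lattice \<Rightarrow> 'a) \<Rightarrow> bool" where
  "abstract_bistochastic E \<longleftrightarrow>
     (\<exists>e f. weak_unit e \<and> strictly_positive_functional f \<and> order_continuous_functional f \<and>
        E 1 e = e \<and> f \<circ> E 1 = f)"

end

theory Submission
  imports Defs
begin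

text \<open>
  Let \<open>e\<close> be the weak unit and \<open>f\<close> the functional of the bistochastic filtration \<open>E\<close>. Since
  \<open>E n (E 1 x) = E 1 (E n x) = E 1 x\<close>, one has \<open>E n e = e\<close> and \<open>f (E n x) = f x\<close> for all
  \<open>n \<ge> 1\<close>, so \<open>(E n x)\<close> is a martingale for the ``expectation'' \<open>f\<close>. The proof is martingale
  theory carried out with lattice operations alone: there is no product, no indicator function
  and no representation of \<open>X\<close> as a space of functions. The place of products is taken by
  finite families of lattice polynomials.

  Norm convergence. For \<open>\<bar>x\<bar> \<le> u\<close> with \<open>E n u = u\<close>, the classical argument takes the increasing
  bounded numbers \<open>f ((E n x)\<^sup>2)\<close> and concludes from the parallelogram law that \<open>(E n x)\<close> is
  Cauchy in mean square. Here the square is replaced by the convex functions \<open>\<bar>x - t u\<bar>\<close>, for \<open>t\<close>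
  in a fine grid of \<open>[-1, 1]\<close>: their sum is convex enough for its defect of linearity at the
  midpoint of \<open>a\<close> and \<open>b\<close> to dominate \<open>\<bar>a - b\<bar>\<close> up to the mesh of the grid
  (\<open>diff_le_sum_convexity_gaps\<close>). So \<open>f \<bar>E m x - E n x\<bar>\<close> tends to zero
  (\<open>f_E_diff_Cauchy\<close>). In an order interval of an order continuous Banach lattice, this
  forces norm convergence (\<open>f_small_imp_norm_small\<close>), because the suprema of the tails of a
  sequence that is summable for \<open>f\<close> decrease to zero. As the \<open>E n\<close> are uniformly bounded and
  the multiples of \<open>e\<close> generate a dense ideal, \<open>(E n x)\<close> converges in norm for every \<open>x\<close>.

  Unbounded order convergence. If \<open>l\<close> is the norm limit then \<open>E n x = E n l\<close>, and with
  \<open>z = \<bar>l - E m l\<bar>\<close> one has \<open>\<bar>E n l - l\<bar> \<le> z + E n z\<close> for \<open>n \<ge> m\<close>, where \<open>f z\<close> is small for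
  large \<open>m\<close>. So it suffices to control the supremum \<open>M\<close> of all \<open>E n z\<close> by \<open>f z\<close>. This is
  Doob's maximal inequality; its lattice form bounds \<open>f (inf (pprt (M - u)) u)\<close> by \<open>f z\<close>, where
  \<open>u\<close> is a small multiple of \<open>e\<close> (\<open>lattice_maximal_inequality\<close>). In the limit
  \<open>m \<rightarrow> \<infinity>\<close>, any vector \<open>v\<close> below all eventual upper bounds of \<open>inf \<bar>E n l - l\<bar> w\<close> satisfies
  \<open>inf (pprt (v - u)) u = 0\<close>, hence \<open>v \<le> u\<close> as \<open>e\<close> is a weak unit. Since \<open>u\<close> was an arbitrarily
  small multiple of \<open>e\<close>, it follows that \<open>v \<le> 0\<close>.
\<close>

section \<open>Lattice-ordered groups\<close>

text \<open>
  Distributivity is automatic in lattice-ordered groups: \<open>a + b = sup a b + inf a b\<close> turns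
  bounds on suprema into bounds on infima.
\<close>

lemma lattice_group_inf_sup_distrib:
  fixes a b c :: "'a::lattice_ab_group_add"
  shows "inf a (sup b c) = sup (inf a b) (inf a c)"
proof (rule order.antisym)
  let ?m = "sup (inf a b) (inf a c)" and ?s = "sup a (sup b c)"
  have b: "b \<le> ?m + ?s - a"
  proof -
    have "a + b \<le> ?s + ?m"
      unfolding add_eq_inf_sup[of a b] by (rule add_mono) (auto intro: le_supI1 le_supI2)
    then show ?thesis by (simp add: le_diff_eq ac_simps)
  qed
  have c: "c \<le> ?m + ?s - a"
  proof -
    have "a + c \<le> ?s + ?m"
      unfolding add_eq_inf_sup[of a c] by (rule add_mono) (auto intro: le_supI1 le_supI2)
    then show ?thesis by (simp add: le_diff_eq ac_simps)
  qed
  have "a + sup b c \<le> ?m + ?s"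
    using le_supI[OF b c] by (simp add: le_diff_eq ac_simps)
  then show "inf a (sup b c) \<le> ?m"
    unfolding add_eq_inf_sup[of a "sup b c"] by (simp add: add.commute)
qed (auto intro: le_infI1 le_infI2 le_supI1 le_supI2)

lemma inf_pprt_pprt_minus:
  fixes x :: "'a::lattice_ab_group_add"
  shows "inf (pprt x) (pprt (- x)) = 0"
proof -
  have "pprt x = x + pprt (- x)"
    using prts[of x] by (metis add_diff_cancel_right' diff_conv_add_uminus pprt_neg)
  then have "inf (pprt x) (pprt (- x)) = inf x 0 + pprt (- x)"
    by (simp add: add_inf_distrib_right)
  also have "\<dots> = 0"
    by (simp add: pprt_neg flip: nprt_def)
  finally show ?thesis .
qed

lemma pprt_sup:
  fixes x y :: "'a::lattice_ab_group_add"
  shows "pprt (sup x y) = sup (pprt x) (pprt y)"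
  by (simp add: pprt_def sup.assoc sup.left_commute)

lemma pprt_diff_sup:
  fixes x y e :: "'a::lattice_ab_group_add"
  shows "pprt (sup x y - e) = sup (pprt (x - e)) (pprt (y - e))"
  using add_sup_distrib_right[of x y "- e"] by (simp add: pprt_sup)

lemma pprt_le_iff:
  fixes x y :: "'a::lattice_ab_group_add"
  shows "pprt x \<le> y \<longleftrightarrow> x \<le> y \<and> 0 \<le> y"
  by (simp add: pprt_def)

lemma le_pprt: "x \<le> pprt (x :: 'a::lattice_ab_group_add)"
  by (simp add: pprt_def)

lemma pprt_add_le:
  fixes x y :: "'a::lattice_ab_group_add"
  shows "pprt (x + y) \<le> pprt x + pprt y"
  by (simp add: pprt_le_iff add_mono le_pprt)

lemma inf_add_le:
  fixes a b u :: "'a::lattice_ab_group_add"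
  assumes "0 \<le> a"
  shows "inf (a + b) u \<le> a + inf b u"
proof -
  have "inf (a + b) u \<le> inf (a + b) (a + u)"
    using assms by (simp add: le_infI2 add_increasing)
  then show ?thesis by (simp add: add_inf_distrib_left)
qed

text \<open>This makes the lattice operations continuous for the norm.\<close>

lemma abs_pprt_diff_le:
  fixes x y :: "'a::lattice_ab_group_add_abs"
  shows "\<bar>pprt x - pprt y\<bar> \<le> \<bar>x - y\<bar>"
proof -
  have *: "pprt x - pprt y \<le> \<bar>x - y\<bar>" for x y :: 'a
  proof -
    have "pprt x = pprt ((x - y) + y)" by simp
    also have "\<dots> \<le> pprt (x - y) + pprt y" by (rule pprt_add_le)
    also have "\<dots> \<le> \<bar>x - y\<bar> + pprt y"
      by (simp add: pprt_le_iff abs_ge_self)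
    finally show ?thesis by (simp add: diff_le_eq)
  qed
  show ?thesis
    using *[of x y] *[of y x] by (simp add: abs_le_iff abs_minus_commute)
qed

primrec running_sup :: "(nat \<Rightarrow> 'a::lattice) \<Rightarrow> nat \<Rightarrow> 'a" where
  "running_sup u 0 = u 0"
| "running_sup u (Suc n) = sup (running_sup u n) (u (Suc n))"

lemma running_sup_incseq: "incseq (running_sup u)"
  by (rule incseq_SucI) simp

lemma running_sup_upper: "i \<le> n \<Longrightarrow> u i \<le> running_sup u n"
  by (induction n) (auto simp: le_Suc_eq intro: le_supI1 le_supI2)

lemma running_sup_least: "(\<And>i. u i \<le> y) \<Longrightarrow> running_sup u n \<le> y"
  by (induction n) auto

section \<open>Banach lattices\<close>

lemma scaleR_inf:
  fixes x y :: "'a::banach_lattice"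
  assumes "0 \<le> c"
  shows "c *\<^sub>R inf x y = inf (c *\<^sub>R x) (c *\<^sub>R y)"
proof (cases "c = 0")
  case False
  then have c: "0 < c" using assms by simp
  show ?thesis
  proof (rule order.antisym)
    have "inf (c *\<^sub>R x) (c *\<^sub>R y) /\<^sub>R c \<le> x" "inf (c *\<^sub>R x) (c *\<^sub>R y) /\<^sub>R c \<le> y"
      using c by (simp_all add: pos_divideR_le_eq)
    then have "inf (c *\<^sub>R x) (c *\<^sub>R y) /\<^sub>R c \<le> inf x y"
      by (rule le_infI)
    then show "inf (c *\<^sub>R x) (c *\<^sub>R y) \<le> c *\<^sub>R inf x y"
      unfolding pos_divideR_le_eq[OF c] .
  qed (use assms in \<open>simp add: scaleR_left_mono\<close>)
qed simp

lemma norm_abs_banach_lattice [simp]: "norm \<bar>x\<bar> = norm (x :: 'a::banach_lattice)"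
  by (rule order.antisym) (simp_all add: norm_mono_abs)

lemma norm_mono_nonneg:
  fixes x y :: "'a::banach_lattice"
  assumes "0 \<le> x" "x \<le> y"
  shows "norm x \<le> norm y"
  using assms by (intro norm_mono_abs) (metis abs_of_nonneg order_trans)

lemma tendsto_pprt:
  fixes X :: "nat \<Rightarrow> 'a::banach_lattice"
  assumes "X \<longlonglongrightarrow> x"
  shows "(\<lambda>n. pprt (X n)) \<longlonglongrightarrow> pprt x"
proof (rule LIM_zero_cancel)
  show "(\<lambda>n. pprt (X n) - pprt x) \<longlonglongrightarrow> 0"
    by (rule Lim_null_comparison[OF _ tendsto_norm_zero[OF LIM_zero[OF assms]]])
       (simp add: norm_mono_abs abs_pprt_diff_le)
qed

lemma tendsto_inf:
  fixes X Y :: "nat \<Rightarrow> 'a::banach_lattice"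
  assumes "X \<longlonglongrightarrow> x" "Y \<longlonglongrightarrow> y"
  shows "(\<lambda>n. inf (X n) (Y n)) \<longlonglongrightarrow> inf x y"
proof -
  have "inf a b = b - pprt (b - a)" for a b :: 'a
    by (simp add: pprt_def add_inf_distrib_left inf_commute)
  then show ?thesis
    by (simp only:) (intro tendsto_diff tendsto_pprt assms)
qed

lemma LIMSEQ_nonneg_banach_lattice:
  fixes X :: "nat \<Rightarrow> 'a::banach_lattice"
  assumes lim: "X \<longlonglongrightarrow> x" and nonneg: "\<And>n. 0 \<le> X n"
  shows "0 \<le> x"
proof -
  have "(\<lambda>n. pprt (X n)) \<longlonglongrightarrow> x"
    using lim nonneg by simp
  then have "x = pprt x"
    using tendsto_pprt[OF lim] by (rule LIMSEQ_unique)
  then show ?thesis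
    using le_zero_iff_pprt_id[of x] by simp
qed

lemma LIMSEQ_le_banach_lattice:
  fixes X Y :: "nat \<Rightarrow> 'a::banach_lattice"
  assumes "X \<longlonglongrightarrow> x" "Y \<longlonglongrightarrow> y" "\<And>n. X n \<le> Y n"
  shows "x \<le> y"
  using LIMSEQ_nonneg_banach_lattice[OF tendsto_diff[OF assms(2,1)]] assms(3) by simp

lemma incseq_LIMSEQ_upper:
  fixes X :: "nat \<Rightarrow> 'a::banach_lattice"
  assumes "incseq X" "X \<longlonglongrightarrow> x"
  shows "X n \<le> x"
  by (rule LIMSEQ_le_banach_lattice[OF tendsto_const LIMSEQ_ignore_initial_segment[OF assms(2), of n]])
     (use assms(1) in \<open>auto simp: incseq_def\<close>)

lemma banach_lattice_archimedean:
  fixes z u :: "'a::banach_lattice"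
  assumes z: "0 \<le> z" and le: "\<And>n::nat. real n *\<^sub>R z \<le> u"
  shows "z = 0"
proof (rule ccontr)
  assume "z \<noteq> 0"
  then obtain n :: nat where n: "norm u < real n * norm z"
    using reals_Archimedean3[of "norm z"] by auto
  have "norm (real n *\<^sub>R z) \<le> norm u"
    using z le[of n] by (intro norm_mono_nonneg) (simp_all add: scaleR_nonneg_nonneg)
  with n show False by simp
qed

lemma le_zero_if_le_all_scaled:
  fixes v e :: "'a::banach_lattice"
  assumes e: "0 \<le> e" and le: "\<And>c. 0 < c \<Longrightarrow> c \<le> 1 \<Longrightarrow> v \<le> c *\<^sub>R e"
  shows "v \<le> 0"
proof -
  have "real n *\<^sub>R pprt v \<le> e" for n
  proof (cases "n = 0")
    case False
    have "v \<le> (1 / real n) *\<^sub>R e"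
      using False by (intro le) auto
    then have "pprt v \<le> (1 / real n) *\<^sub>R e"
      using e by (simp add: pprt_le_iff scaleR_nonneg_nonneg)
    then have "real n *\<^sub>R pprt v \<le> real n *\<^sub>R ((1 / real n) *\<^sub>R e)"
      by (intro scaleR_left_mono) auto
    then show ?thesis using False by simp
  qed (use e in simp)
  then have "pprt v = 0"
    by (intro banach_lattice_archimedean[where u = e]) auto
  then show ?thesis by (simp add: le_zero_iff_zero_pprt)
qed

text \<open>
  The differences \<open>y - X n\<close>, for \<open>y\<close> an upper
  bound of the sequence, form a net that decreases to zero: a positive lower bound of it may be
  subtracted from \<open>y\<close> again and again without leaving the set of upper bounds, which the
  Archimedean property excludes. So this net is norm null, and the sequence is Cauchy.
\<close>

lemma incseq_bounded_convergent:
  fixes X :: "nat \<Rightarrow> 'a::banach_lattice"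
  assumes oc: "order_continuous_lattice TYPE('a)"
    and inc: "incseq X" and bound: "\<And>n. X n \<le> u"
  shows "convergent X"
proof -
  define U where "U = {y. \<forall>n. X n \<le> y}"
  define I where "I = U \<times> (UNIV :: nat set)"
  define le where "le a b \<longleftrightarrow> fst b \<le> fst a \<and> snd a \<le> snd b" for a b :: "'a \<times> nat"
  define d where "d = (\<lambda>(y, n). y - X n)"
  have uU: "u \<in> U" using bound by (simp add: U_def)
  have "\<exists>c\<in>I. le a c \<and> le b c" if "a \<in> I" "b \<in> I" for a b
  proof -
    have "inf (fst a) (fst b) \<in> U"
      using that by (auto simp: I_def U_def)
    then show ?thesis
      by (intro bexI[of _ "(inf (fst a) (fst b), max (snd a) (snd b))"])
         (auto simp: I_def le_def split: prod.split)
  qed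
  moreover have "I \<noteq> {}" using uU by (auto simp: I_def)
  ultimately have dir: "directed_index I le"
    by (auto simp: directed_index_def reflp_on_def transp_on_def le_def)
  have d_nonneg: "0 \<le> d a" if "a \<in> I" for a
    using that by (auto simp: d_def I_def U_def)
  have mono: "monotone_on I le (\<ge>) d"
    using inc by (auto simp: monotone_on_def le_def d_def incseq_def intro!: diff_mono)
  have glb: "isGlb UNIV (d ` I) 0"
  proof -
    have "v \<le> 0" if v: "\<And>a. a \<in> I \<Longrightarrow> v \<le> d a" for v
    proof -
      have step: "y - pprt v \<in> U" if "y \<in> U" for y
      proof -
        have "pprt v \<le> y - X n" for n
          using v[of "(y, n)"] d_nonneg[of "(y, n)"] that
          by (simp add: pprt_le_iff I_def d_def)
        then show ?thesis by (simp add: U_def le_diff_eq add.commute)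
      qed
      have "u - real k *\<^sub>R pprt v \<in> U" for k
      proof (induction k)
        case (Suc k)
        then show ?case
          using step[OF Suc] by (simp add: algebra_simps)
      qed (use uU in simp)
      then have "real k *\<^sub>R pprt v \<le> u - X 0" for k
        by (simp add: U_def le_diff_eq add.commute)
      then have "pprt v = 0"
        by (intro banach_lattice_archimedean) auto
      then show ?thesis by (simp add: le_zero_iff_zero_pprt)
    qed
    then show ?thesis
      using d_nonneg by (auto simp: isGlb_def greatestP_def isLb_def setge_def setle_def)
  qed
  have "decreases_to_zero I le d"
    using dir mono glb by (simp add: decreases_to_zero_def)
  then have "order_converges_to I le d 0"
  proof (rule order_converges_toI)
    fix b assume b: "b \<in> I"
    show "net_eventually I le (\<lambda>a. \<bar>d a - 0\<bar> \<le> d b)"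
      unfolding net_eventually_def using b mono d_nonneg
      by (intro bexI[OF _ b]) (auto simp: monotone_on_def)
  qed
  then have null: "norm_null_net I le d"
    by (rule order_continuous_latticeD[OF oc])
  have "Cauchy X"
  proof (rule CauchyI)
    fix r :: real assume "0 < r"
    then have "net_eventually I le (\<lambda>a. norm (d a) < r / 2)"
      using null half_gt_zero unfolding norm_null_net_def by blast
    then obtain y n where yn: "(y, n) \<in> I" "\<And>a. a \<in> I \<Longrightarrow> le (y, n) a \<Longrightarrow> norm (d a) < r / 2"
      unfolding net_eventually_def by auto
    have small: "norm (y - X m) < r / 2" if "n \<le> m" for m
      using yn(2)[of "(y, m)"] yn(1) that by (auto simp: I_def le_def d_def)
    have "norm (X m - X k) < r" if "n \<le> m" "n \<le> k" for m k
    proof -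
      have "X m - X k = (y - X k) - (y - X m)" by simp
      then have "norm (X m - X k) \<le> norm (y - X k) + norm (y - X m)"
        by (metis norm_triangle_ineq4)
      then show ?thesis
        using small[OF that(1)] small[OF that(2)] by linarith
    qed
    then show "\<exists>M. \<forall>m\<ge>M. \<forall>n\<ge>M. norm (X m - X n) < r" by blast
  qed
  then show ?thesis by (rule Cauchy_convergent)
qed

section \<open>Strictly positive functionals\<close>

locale strictly_positive =
  fixes f :: "'a::banach_lattice \<Rightarrow> real"
  assumes strictly_positive_functional: "strictly_positive_functional f"
begin

lemma f_linear: "linear f"
  and f_nonneg: "0 \<le> x \<Longrightarrow> 0 \<le> f x"
  using strictly_positive_functional by (auto simp: strictly_positive_functional_def)

lemmas f_simps = linear_add[OF f_linear] linear_diff[OF f_linear] linear_scale[OF f_linear]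
  linear_0[OF f_linear] linear_sum[OF f_linear]

lemma f_mono: "x \<le> y \<Longrightarrow> f x \<le> f y"
  using f_nonneg[of "y - x"] by (simp add: f_simps)

lemma eq_0_if_f_le_0: "0 \<le> x \<Longrightarrow> f x \<le> 0 \<Longrightarrow> x = 0"
  using strictly_positive_functional
  unfolding strictly_positive_functional_def by (metis order.antisym)

lemma abs_f_le: "\<bar>f x\<bar> \<le> f \<bar>x\<bar>"
proof -
  have "f (- x) \<le> f \<bar>x\<bar>" "f x \<le> f \<bar>x\<bar>"
    by (rule f_mono, simp add: abs_ge_minus_self abs_ge_self)+
  then show ?thesis by (simp add: linear_neg[OF f_linear] abs_le_iff)
qed

text \<open>
  Positivity implies continuity: otherwise there are positive \<open>y n\<close> of norm \<open>(1/2)^n\<close> with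
  \<open>f (y n) > n\<close>, and \<open>f\<close> would be infinite at their sum.
\<close>

lemma f_bounded_linear: "bounded_linear f"
proof -
  have "\<exists>K. \<forall>x\<ge>0. f x \<le> K * norm x"
  proof (rule ccontr)
    assume "\<not> ?thesis"
    then have "\<forall>n. \<exists>x\<ge>0. real n * 2 ^ n * norm x < f x"
      by (auto simp: not_le)
    then obtain z where z: "\<And>n. 0 \<le> z n" "\<And>n. real n * 2 ^ n * norm (z n) < f (z n)"
      by metis
    have z0: "norm (z n) > 0" for n
      using z(2)[of n] by (cases "z n = 0") (auto simp: f_simps)
    define y where "y n = (1 / (2 ^ n * norm (z n))) *\<^sub>R z n" for n
    have y_nonneg: "0 \<le> y n" for n
      using z(1) by (simp add: y_def scaleR_nonneg_nonneg)
    have norm_y: "norm (y n) = (1 / 2) ^ n" for n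
      using z0[of n] by (simp add: y_def power_one_over field_simps)
    have f_y: "real n < f (y n)" for n
      using z(2)[of n] z0[of n] by (simp add: y_def f_simps field_simps)
    have "summable y"
      by (rule summable_norm_cancel) (simp add: norm_y summable_geometric)
    then have lim: "(\<lambda>k. \<Sum>i<k. y i) \<longlonglongrightarrow> suminf y"
      by (rule summable_LIMSEQ)
    have inc: "incseq (\<lambda>k. \<Sum>i<k. y i)"
      by (rule incseq_SucI) (simp add: y_nonneg)
    have "y n \<le> suminf y" for n
    proof -
      have "y n \<le> (\<Sum>i<Suc n. y i)"
        by (simp add: y_nonneg sum_nonneg)
      also have "\<dots> \<le> suminf y"
        by (rule incseq_LIMSEQ_upper[OF inc lim])
      finally show ?thesis .
    qed
    then have "real n < f (suminf y)" for n
      using f_y[of n] f_mono less_le_trans by blast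
    then show False
      using reals_Archimedean2[of "f (suminf y)"] by (meson less_asym)
  qed
  then obtain K where K: "\<And>x. 0 \<le> x \<Longrightarrow> f x \<le> K * norm x" by blast
  have "norm (f x) \<le> norm x * K" for x
    using abs_f_le[of x] K[of "\<bar>x\<bar>"] by (simp add: mult.commute)
  then show ?thesis
    by (intro bounded_linear_intro[of f K]) (simp_all add: f_simps)
qed

lemmas tendsto_f = bounded_linear.tendsto[OF f_bounded_linear]

lemma f_running_sup_le:
  assumes "\<And>i. 0 \<le> u i"
  shows "f (running_sup u n) \<le> (\<Sum>i\<le>n. f (u i))"
proof (induction n)
  case (Suc n)
  have "0 \<le> running_sup u n"
    using assms running_sup_upper[of 0 n u] order_trans by blast
  then have "f (running_sup u (Suc n)) \<le> f (running_sup u n + u (Suc n))"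
    using assms by (intro f_mono) simp
  with Suc show ?case by (simp add: f_simps)
qed simp

text \<open>
  On order intervals, \<open>f \<bar>x\<bar>\<close> controls the norm. In a counterexample \<open>x k\<close> with
  \<open>f \<bar>x k\<bar> < (1/2)^k\<close>, the suprema \<open>y k\<close> of the tails decrease to some \<open>y \<ge> 0\<close> with \<open>f y = 0\<close>.
  Strict positivity gives \<open>y = 0\<close>, and monotone sequences converge in norm, so the \<open>y k\<close>, which
  dominate the \<open>x k\<close>, are norm null.
\<close>

lemma f_small_imp_norm_small:
  assumes oc: "order_continuous_lattice TYPE('a)" and r: "0 < r"
  obtains d where "0 < d" "\<And>x. \<bar>x\<bar> \<le> u \<Longrightarrow> f \<bar>x\<bar> < d \<Longrightarrow> norm x < r"
proof (rule ccontr)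
  assume "\<not> thesis"
  then have "\<forall>d>0. \<exists>x. \<bar>x\<bar> \<le> u \<and> f \<bar>x\<bar> < d \<and> r \<le> norm x"
    using that by (meson not_le)
  then have "\<forall>k::nat. \<exists>x. \<bar>x\<bar> \<le> u \<and> f \<bar>x\<bar> < (1 / 2) ^ k \<and> r \<le> norm x"
    by simp
  then obtain x :: "nat \<Rightarrow> 'a" where x: "\<And>k. \<bar>x k\<bar> \<le> u" "\<And>k. f \<bar>x k\<bar> < (1 / 2) ^ k" "\<And>k. r \<le> norm (x k)"
    by metis
  define S where "S k = running_sup (\<lambda>i. \<bar>x (k + i)\<bar>)" for k
  have "convergent (S k)" for k
    unfolding S_def
    by (rule incseq_bounded_convergent[OF oc running_sup_incseq running_sup_least]) (rule x(1))
  then obtain y where y: "\<And>k. S k \<longlonglongrightarrow> y k"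
    unfolding convergent_def by metis
  have x_le_y: "\<bar>x (k + i)\<bar> \<le> y k" for k i
  proof -
    have "\<bar>x (k + i)\<bar> \<le> S k i"
      unfolding S_def using running_sup_upper[of i i "\<lambda>i. \<bar>x (k + i)\<bar>"] by simp
    also have "\<dots> \<le> y k"
      by (rule incseq_LIMSEQ_upper[OF _ y]) (simp add: S_def running_sup_incseq)
    finally show ?thesis .
  qed
  have y_nonneg: "0 \<le> y k" for k
    using x_le_y[of k 0] abs_ge_zero order_trans by blast
  have y_dec: "y (Suc k) \<le> y k" for k
  proof (rule LIMSEQ_le_banach_lattice[OF y tendsto_const])
    show "S (Suc k) n \<le> y k" for n
      unfolding S_def
    proof (rule running_sup_least)
      show "\<bar>x (Suc k + i)\<bar> \<le> y k" for i
        using x_le_y[of k "Suc i"] by simp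
    qed
  qed
  have f_y: "f (y k) \<le> 2 * (1 / 2) ^ k" for k
  proof (rule LIMSEQ_le_const2[OF tendsto_f[OF y]])
    have "f (S k n) \<le> 2 * (1 / 2) ^ k" for n
    proof -
      have "f (S k n) \<le> (\<Sum>i\<le>n. f \<bar>x (k + i)\<bar>)"
        unfolding S_def by (rule f_running_sup_le) simp
      also have "\<dots> \<le> (\<Sum>i\<le>n. (1 / 2) ^ k * (1 / 2) ^ i)"
        by (intro sum_mono) (metis less_imp_le x(2) power_add)
      also have "\<dots> = (1 / 2) ^ k * (\<Sum>i\<le>n. (1 / 2) ^ i)"
        by (simp add: sum_distrib_left)
      also have "\<dots> \<le> (1 / 2) ^ k * 2"
      proof (rule mult_left_mono)
        have "(\<Sum>i\<le>n. (1 / 2) ^ i) = 2 - (1 / 2 :: real) ^ n"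
          by (induction n) simp_all
        then show "(\<Sum>i\<le>n. (1 / 2) ^ i) \<le> (2 :: real)"
          by simp
      qed simp
      finally show ?thesis by simp
    qed
    then show "\<exists>N. \<forall>n\<ge>N. f (S k n) \<le> 2 * (1 / 2) ^ k" by blast
  qed
  have "convergent (\<lambda>k. - y k)"
    by (rule incseq_bounded_convergent[OF oc, of _ 0]) (simp_all add: incseq_SucI y_dec y_nonneg)
  then obtain y' where "(\<lambda>k. - y k) \<longlonglongrightarrow> y'"
    by (auto simp: convergent_def)
  then have lim: "y \<longlonglongrightarrow> - y'"
    using tendsto_minus by fastforce
  have "(\<lambda>k. 2 * (1 / 2) ^ k :: real) \<longlonglongrightarrow> 2 * 0"
    by (intro tendsto_mult tendsto_const LIMSEQ_realpow_zero) auto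
  then have "f (- y') \<le> 2 * 0"
    by (rule LIMSEQ_le[OF tendsto_f[OF lim]]) (use f_y in blast)
  then have "- y' = 0"
    using LIMSEQ_nonneg_banach_lattice[OF lim y_nonneg] by (intro eq_0_if_f_le_0) auto
  with lim have "(\<lambda>k. norm (y k)) \<longlonglongrightarrow> 0"
    by (simp add: tendsto_norm_zero)
  moreover have "r \<le> norm (y k)" for k
    using x(3)[of k] x_le_y[of k 0] norm_mono_nonneg[of "\<bar>x k\<bar>" "y k"] by simp
  ultimately have "r \<le> 0"
    by (intro LIMSEQ_le_const) auto
  with r show False by simp
qed

text \<open>
  The range of a conditional expectation is a sublattice: positivity gives
  \<open>sup x y \<le> P (sup x y)\<close>, and a strictly positive \<open>f\<close> with equal values on both sides
  leaves no room for a strict inequality.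
\<close>

lemma fixed_sup:
  assumes P: "positive_operator P" and fP: "\<And>x. f (P x) = f x"
    and "P x = x" "P y = y"
  shows "P (sup x y) = sup x y"
proof -
  have lin: "linear P" using P by (simp add: positive_operator_def)
  have mono: "P a \<le> P b" if "a \<le> b" for a b
  proof -
    have "0 \<le> P (b - a)" using P that by (simp add: positive_operator_def)
    then show ?thesis by (simp add: linear_diff[OF lin])
  qed
  have "sup x y \<le> P (sup x y)"
    using mono[of x "sup x y"] mono[of y "sup x y"] assms(3,4) by simp
  moreover have "f (P (sup x y) - sup x y) = 0"
    by (simp only: f_simps fP diff_self)
  ultimately have "P (sup x y) - sup x y = 0"
    by (intro eq_0_if_f_le_0) (simp_all only: diff_ge_0_iff_ge order_refl)
  then show ?thesis by (simp only: right_minus_eq)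
qed

lemma fixed_inf:
  assumes P: "positive_operator P" and fP: "\<And>x. f (P x) = f x"
    and "P x = x" "P y = y"
  shows "P (inf x y) = inf x y"
proof -
  have lin: "linear P" using P by (simp add: positive_operator_def)
  have "inf x y = - sup (- x) (- y)" by simp
  then show ?thesis
    using fixed_sup[OF P fP, of "- x" "- y"] assms(3,4) by (simp only: linear_neg[OF lin])
qed

end

section \<open>Convexity on a grid\<close>

text \<open>
  For \<open>p = a - t\<close> and \<open>q = t - b\<close> the right-hand side below is the defect of linearity of
  \<open>\<bar>\<cdot> - t\<bar>\<close> between \<open>a\<close> and \<open>b\<close>, and the left-hand side is large when \<open>t\<close> lies well between them.
\<close>

lemma double_inf_le_convexity_gap:
  fixes p q :: "'a::banach_lattice"
  shows "2 *\<^sub>R inf p q \<le> \<bar>p\<bar> + \<bar>q\<bar> - \<bar>p - q\<bar>"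
proof -
  have "p - q \<le> p + q - 2 *\<^sub>R inf p q"
    using scaleR_left_mono[of "inf p q" q 2] by (simp add: algebra_simps scaleR_2)
  moreover have "- (p - q) \<le> p + q - 2 *\<^sub>R inf p q"
    using scaleR_left_mono[of "inf p q" p 2] by (simp add: algebra_simps scaleR_2)
  ultimately have "\<bar>p - q\<bar> \<le> p + q - 2 *\<^sub>R inf p q"
    by (rule abs_leI)
  also have "\<dots> \<le> \<bar>p\<bar> + \<bar>q\<bar> - 2 *\<^sub>R inf p q"
    by (intro diff_right_mono add_mono abs_ge_self)
  finally show ?thesis by (simp add: algebra_simps)
qed

text \<open>
  The substitute for the parallelogram law. For real numbers with \<open>a - b > 2/N + R\<close>, where \<open>R\<close>
  is the sum of the gaps, walk along the grid from \<open>-1\<close> to \<open>1\<close>. At every grid point one of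
  \<open>a - t k\<close> and \<open>t k - b\<close> is at most \<open>R / 2\<close>. At the left end it is \<open>t k - b\<close>. If it is
  \<open>t k - b\<close> at some grid point, then at the next one it cannot be \<open>a - t (k + 1)\<close>, since
  these two numbers add up to \<open>a - b - 2/N > R\<close>. So \<open>t k - b \<le> R / 2\<close> at the right end as
  well, where \<open>a \<le> 1 = t k\<close> makes \<open>a - b\<close> too small. In a lattice, ``\<open>t k - b \<le> R / 2\<close> wherever the excess \<open>c\<close> is positive''
  becomes \<open>inf c (q k) \<le> 0\<close>.
\<close>

lemma diff_le_sum_convexity_gaps:
  fixes a b e :: "'a::banach_lattice" and N :: nat
  defines "t \<equiv> \<lambda>k. real k * (2 / real N) - 1"
  assumes a: "a \<le> e" and b: "- e \<le> b" "b \<le> e" and N: "0 < N"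
  shows "a - b \<le> (2 / real N) *\<^sub>R e +
    (\<Sum>k\<le>N. \<bar>a - t k *\<^sub>R e\<bar> + \<bar>b - t k *\<^sub>R e\<bar> - \<bar>a + b - (2 * t k) *\<^sub>R e\<bar>)"
proof -
  define gap where "gap k = \<bar>a - t k *\<^sub>R e\<bar> + \<bar>b - t k *\<^sub>R e\<bar> - \<bar>a + b - (2 * t k) *\<^sub>R e\<bar>" for k
  define R where "R = (\<Sum>k\<le>N. gap k)"
  define p where "p k = 2 *\<^sub>R (a - t k *\<^sub>R e) - R" for k
  define q where "q k = 2 *\<^sub>R (t k *\<^sub>R e - b) - R" for k
  define c where "c = a - b - (2 / real N) *\<^sub>R e - R"
  have gap_nonneg: "0 \<le> gap k" for k
  proof -
    have "a + b - (2 * t k) *\<^sub>R e = (a - t k *\<^sub>R e) + (b - t k *\<^sub>R e)"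
      by (simp add: algebra_simps flip: scaleR_2)
    then show ?thesis
      unfolding gap_def by (metis abs_triangle_ineq diff_ge_0_iff_ge)
  qed
  have R: "0 \<le> R" by (simp add: R_def sum_nonneg gap_nonneg)
  have pq: "inf (p k) (q k) \<le> 0" if "k \<le> N" for k
  proof -
    have "inf (p k) (q k) = 2 *\<^sub>R inf (a - t k *\<^sub>R e) (t k *\<^sub>R e - b) - R"
      using add_inf_distrib_right[of "2 *\<^sub>R (a - t k *\<^sub>R e)" "2 *\<^sub>R (t k *\<^sub>R e - b)" "- R"]
      by (simp add: p_def q_def scaleR_inf)
    also have "\<dots> \<le> gap k - R"
    proof (rule diff_right_mono)
      have "(a - t k *\<^sub>R e) - (t k *\<^sub>R e - b) = a + b - (2 * t k) *\<^sub>R e"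
        by (simp add: algebra_simps flip: scaleR_2)
      then show "2 *\<^sub>R inf (a - t k *\<^sub>R e) (t k *\<^sub>R e - b) \<le> gap k"
        using double_inf_le_convexity_gap[of "a - t k *\<^sub>R e" "t k *\<^sub>R e - b"]
        unfolding gap_def by (simp only: abs_minus_commute[of b])
    qed
    also have "\<dots> \<le> 0"
      using sum_mono2[of "{..N}" "{k}" gap] gap_nonneg that by (simp add: R_def)
    finally show ?thesis .
  qed
  have "inf c (q k) \<le> 0" if "k \<le> N" for k
    using that
  proof (induction k)
    case 0
    have "2 *\<^sub>R (- e - b) \<le> 0"
      using scaleR_left_mono[of "- e - b" 0 2] b(1) by simp
    then have "q 0 \<le> 0"
      using R by (simp add: q_def t_def)
    then show ?case by (simp add: le_infI2)
  next
    case (Suc k)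
    \<comment> \<open>As \<open>?p + q k = c + c\<close>, the excess \<open>c\<close> lies below \<open>sup ?p (q k)\<close>; the infimum of
      \<open>c\<close> and \<open>q k\<close> is nonpositive by induction, that of \<open>?p\<close> and \<open>q (Suc k)\<close> by \<open>pq\<close>.\<close>
    let ?p = "p (Suc k)"
    have "t (Suc k) = t k + 2 / real N"
      unfolding t_def of_nat_Suc distrib_right by simp
    moreover have "2 *\<^sub>R (a - (y + z)) - R + (2 *\<^sub>R (y - b) - R) =
        (a - b - z - R) + (a - b - z - R)" for y z
      by (simp add: algebra_simps scaleR_2)
    ultimately have "?p + q k = c + c"
      by (simp only: p_def q_def c_def scaleR_left_distrib)
    then have "2 *\<^sub>R c \<le> 2 *\<^sub>R sup ?p (q k)"
      unfolding scaleR_2 using add_mono[of ?p "sup ?p (q k)" "q k" "sup ?p (q k)"] by simp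
    then have "c \<le> sup ?p (q k)"
      by (simp only: scaleR_le_cancel_left_pos zero_less_numeral)
    then have "inf c (q (Suc k)) \<le> inf (inf c (q (Suc k))) (sup ?p (q k))"
      by (simp add: le_infI1)
    also have "\<dots> = sup (inf (inf c (q (Suc k))) ?p) (inf (inf c (q (Suc k))) (q k))"
      by (rule lattice_group_inf_sup_distrib)
    also have "\<dots> \<le> sup (inf ?p (q (Suc k))) (inf c (q k))"
      by (intro sup_mono le_infI) (simp_all add: le_infI1)
    also have "\<dots> \<le> 0"
      using pq[OF Suc.prems] Suc by simp
    finally show ?case .
  qed
  from this[of N] have "inf c (q N) \<le> 0" by simp
  moreover have "c \<le> q N"
  proof -
    have "0 \<le> e" using order_trans[OF b] by (simp add: minus_le_self_iff)
    have "a - b - (2 / real N) *\<^sub>R e \<le> e - b - 0"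
      using \<open>0 \<le> e\<close> a by (intro diff_mono) (simp_all add: scaleR_nonneg_nonneg)
    also have "\<dots> \<le> 2 *\<^sub>R (e - b)"
      using b(2) by (simp add: scaleR_2)
    finally have "c \<le> 2 *\<^sub>R (e - b) - R"
      unfolding c_def by (rule diff_right_mono)
    moreover have "t N = 1" using N by (simp add: t_def)
    ultimately show ?thesis by (simp add: q_def)
  qed
  ultimately have "c \<le> 0" by (simp add: inf_absorb1)
  then have "a - b \<le> R + (2 / real N) *\<^sub>R e"
    by (simp only: c_def diff_le_eq add_0)
  then show ?thesis
    unfolding R_def gap_def by (subst add.commute)
qed

section \<open>Filtrations\<close>

locale bistochastic_filtration = strictly_positive f
  for f :: "'a::banach_lattice \<Rightarrow> real" +
  fixes E :: "nat \<Rightarrow> 'a \<Rightarrow> 'a" and e :: 'a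
  assumes order_continuous: "order_continuous_lattice TYPE('a)"
    and bounded_filtration: "bounded_filtration E"
    and weak_unit: "weak_unit e"
    and E_1_e: "E 1 e = e"
    and f_E_1: "f \<circ> E 1 = f"
begin

lemma E_positive: "1 \<le> n \<Longrightarrow> positive_operator (E n)"
  and E_bounded_linear: "1 \<le> n \<Longrightarrow> bounded_linear (E n)"
  using bounded_filtration by (auto simp: bounded_filtration_def filtration_def)

lemma E_E:
  assumes "1 \<le> n" "1 \<le> m"
  shows "E n (E m x) = E (min m n) x"
proof -
  have "E n \<circ> E m = E (min m n)"
    using bounded_filtration assms unfolding bounded_filtration_def filtration_def by blast
  then show ?thesis by (simp add: fun_eq_iff)
qed

lemma E_linear: "1 \<le> n \<Longrightarrow> linear (E n)"
  and E_nonneg: "1 \<le> n \<Longrightarrow> 0 \<le> x \<Longrightarrow> 0 \<le> E n x"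
  using E_positive by (auto simp: positive_operator_def)

lemma E_mono:
  assumes n: "1 \<le> n" and "x \<le> y"
  shows "E n x \<le> E n y"
  using E_nonneg[OF n, of "y - x"] assms(2) by (simp add: linear_diff[OF E_linear[OF n]])

lemma abs_E_le:
  assumes n: "1 \<le> n"
  shows "\<bar>E n x\<bar> \<le> E n \<bar>x\<bar>"
proof (rule abs_leI)
  show "E n x \<le> E n \<bar>x\<bar>"
    by (rule E_mono[OF n]) (rule abs_ge_self)
  show "- E n x \<le> E n \<bar>x\<bar>"
    using E_mono[OF n abs_ge_minus_self[of x]] by (simp add: linear_neg[OF E_linear[OF n]])
qed

lemma f_E: "1 \<le> n \<Longrightarrow> f (E n x) = f x"
  using E_E[of 1 n x] f_E_1 by (metis comp_apply le_refl min_absorb2)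

lemma E_e: "1 \<le> n \<Longrightarrow> E n e = e"
  using E_E[of n 1 e] E_1_e by (simp add: min_absorb1)

lemma e_nonneg: "0 \<le> e"
  using weak_unit by (simp add: weak_unit_def less_imp_le)

section \<open>Norm convergence of martingales\<close>

text \<open>
  By Jensen's inequality \<open>f \<bar>E n x - t u\<bar>\<close> increases with \<open>n\<close>. The midpoint of \<open>E m x\<close> and
  \<open>E n x\<close> is also mapped to \<open>E n x\<close> by \<open>E n\<close> when \<open>n \<le> m\<close>, so \<open>f\<close> maps the gap of \<open>\<bar>\<cdot> - t u\<bar>\<close>
  between these two vectors to at most \<open>f \<bar>E m x - t u\<bar> - f \<bar>E n x - t u\<bar>\<close>, the increment
  of a convergent sequence of numbers.
\<close>

lemma f_E_diff_Cauchy: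
  assumes x: "\<bar>x\<bar> \<le> u" and u: "\<And>n. 1 \<le> n \<Longrightarrow> E n u = u" and r: "0 < r"
  shows "\<exists>M. \<forall>n\<ge>M. \<forall>m\<ge>n. f \<bar>E (Suc m) x - E (Suc n) x\<bar> < r"
proof -
  define X where "X n = E (Suc n) x" for n
  have X_le: "\<bar>X n\<bar> \<le> u" for n
    using abs_E_le[of "Suc n" x] E_mono[of "Suc n" "\<bar>x\<bar>" u] x u[of "Suc n"]
    by (simp add: X_def)
  have E_X: "E (Suc n) (X m) = X n" if "n \<le> m" for n m
    using that by (simp add: X_def E_E)
  \<comment> \<open>the mesh \<open>2 / N\<close> of the grid must contribute less than \<open>r\<close>\<close>
  obtain N :: nat where N: "2 * f u / r < real N" and N0: "0 < N"
  proof -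
    obtain N :: nat where "2 * f u / r < real N"
      using reals_Archimedean2 by blast
    then show thesis by (intro that[of "Suc N"]) auto
  qed
  define t where "t k = real k * (2 / real N) - 1" for k
  define \<phi> where "\<phi> k n = f \<bar>X n - t k *\<^sub>R u\<bar>" for k n
  define \<Phi> where "\<Phi> n = (\<Sum>k\<le>N. \<phi> k n)" for n
  have gap: "f \<bar>X m - X n\<bar> \<le> (2 / real N) * f u + (\<Phi> m - \<Phi> n)" if "n \<le> m" for m n
  proof -
    define R where "R = (\<Sum>k\<le>N. \<bar>X m - t k *\<^sub>R u\<bar> + \<bar>X n - t k *\<^sub>R u\<bar> - \<bar>X m + X n - (2 * t k) *\<^sub>R u\<bar>)"
    have bounds: "X i \<le> u" "- u \<le> X i" for i
      using X_le[of i] by (simp_all add: abs_le_iff minus_le_iff)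
    have "X m - X n \<le> (2 / real N) *\<^sub>R u + R"
      unfolding R_def t_def by (rule diff_le_sum_convexity_gaps[OF bounds(1,2,1) N0])
    moreover have "X n - X m \<le> (2 / real N) *\<^sub>R u + R"
      using diff_le_sum_convexity_gaps[OF bounds(1,2,1) N0, of n m]
      unfolding R_def t_def by (simp only: ac_simps)
    ultimately have "\<bar>X m - X n\<bar> \<le> (2 / real N) *\<^sub>R u + R"
      by (simp add: abs_le_iff)
    then have "f \<bar>X m - X n\<bar> \<le> f ((2 / real N) *\<^sub>R u + R)"
      by (rule f_mono)
    also have "\<dots> = (2 / real N) * f u + f R"
      by (simp add: f_simps)
    also have "f R \<le> (\<Sum>k\<le>N. \<phi> k m - \<phi> k n)"
      unfolding R_def f_simps(5)
    proof (rule sum_mono)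
      fix k
      let ?y = "X m + X n - (2 * t k) *\<^sub>R u"
      \<comment> \<open>\<open>?y / 2\<close> is the midpoint of the two vectors, shifted by \<open>t k *\<^sub>R u\<close>\<close>
      have "E (Suc n) ?y = 2 *\<^sub>R (X n - t k *\<^sub>R u)"
        using that u[of "Suc n"]
        by (simp add: linear_add[OF E_linear] linear_diff[OF E_linear] linear_scale[OF E_linear]
            E_X algebra_simps scaleR_2)
      then have "2 *\<^sub>R (X n - t k *\<^sub>R u) \<le> E (Suc n) \<bar>?y\<bar>" "2 *\<^sub>R (- (X n - t k *\<^sub>R u)) \<le> E (Suc n) \<bar>?y\<bar>"
        using abs_E_le[of "Suc n" ?y] by (simp_all only: abs_le_iff scaleR_minus_right)
      then have "\<bar>X n - t k *\<^sub>R u\<bar> \<le> E (Suc n) \<bar>?y\<bar> /\<^sub>R 2"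
        by (intro abs_leI) (simp_all only: pos_le_divideR_eq zero_less_numeral)
      then have "2 *\<^sub>R \<bar>X n - t k *\<^sub>R u\<bar> \<le> E (Suc n) \<bar>?y\<bar>"
        by (simp only: pos_le_divideR_eq zero_less_numeral)
      then have "f (2 *\<^sub>R \<bar>X n - t k *\<^sub>R u\<bar>) \<le> f (E (Suc n) \<bar>?y\<bar>)"
        by (rule f_mono)
      then have "2 * \<phi> k n \<le> f \<bar>?y\<bar>"
        by (simp add: f_E f_simps \<phi>_def)
      then show "f (\<bar>X m - t k *\<^sub>R u\<bar> + \<bar>X n - t k *\<^sub>R u\<bar> - \<bar>?y\<bar>) \<le> \<phi> k m - \<phi> k n"
        by (simp only: f_simps \<phi>_def)
    qed
    also have "\<dots> = \<Phi> m - \<Phi> n"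
      by (simp add: \<Phi>_def sum_subtractf)
    finally show ?thesis by simp
  qed
  have "incseq \<Phi>"
    unfolding \<Phi>_def incseq_def
  proof (intro allI impI sum_mono)
    fix n m k :: nat assume "n \<le> m"
    then have "X n - t k *\<^sub>R u = E (Suc n) (X m - t k *\<^sub>R u)"
      using u[of "Suc n"] by (simp add: linear_diff[OF E_linear] linear_scale[OF E_linear] E_X)
    then have "\<phi> k n \<le> f (E (Suc n) \<bar>X m - t k *\<^sub>R u\<bar>)"
      unfolding \<phi>_def by (metis abs_E_le f_mono le_add1 plus_1_eq_Suc)
    then show "\<phi> k n \<le> \<phi> k m"
      by (simp add: f_E \<phi>_def)
  qed
  moreover have "\<Phi> n \<le> (\<Sum>k\<le>N. f (u + \<bar>t k *\<^sub>R u\<bar>))" for n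
    unfolding \<Phi>_def \<phi>_def
    by (intro sum_mono f_mono) (meson X_le abs_triangle_ineq4 add_right_mono order_trans)
  ultimately have "convergent \<Phi>"
    by (meson incseq_convergent convergentI)
  then have "Cauchy \<Phi>"
    by (rule convergent_Cauchy)
  then obtain M where M: "\<And>m n. M \<le> m \<Longrightarrow> M \<le> n \<Longrightarrow> norm (\<Phi> m - \<Phi> n) < r - 2 / real N * f u"
  proof -
    have "0 < r - 2 / real N * f u"
      using N N0 r by (simp add: field_simps)
    with \<open>Cauchy \<Phi>\<close> show thesis
      using that unfolding Cauchy_def dist_norm by blast
  qed
  have "f \<bar>X m - X n\<bar> < r" if "M \<le> n" "n \<le> m" for m n
    using gap[OF that(2)] M[of m n] that by simp
  then show ?thesis by (auto simp: X_def)
qed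

lemma E_convergent_if_dominated:
  assumes x: "\<bar>x\<bar> \<le> u" and u: "\<And>n. 1 \<le> n \<Longrightarrow> E n u = u"
  shows "convergent (\<lambda>n. E n x)"
proof -
  have E_le: "\<bar>E (Suc n) x\<bar> \<le> u" for n
    using abs_E_le[of "Suc n" x] E_mono[of "Suc n" "\<bar>x\<bar>" u] x u[of "Suc n"] by simp
  have "Cauchy (\<lambda>n. E (Suc n) x)"
  proof (rule CauchyI')
    fix r :: real assume "0 < r"
    then obtain d where d: "0 < d" "\<And>y. \<bar>y\<bar> \<le> u + u \<Longrightarrow> f \<bar>y\<bar> < d \<Longrightarrow> norm y < r"
      using f_small_imp_norm_small[OF order_continuous] by blast
    obtain M where M: "\<And>m n. M \<le> n \<Longrightarrow> n \<le> m \<Longrightarrow> f \<bar>E (Suc m) x - E (Suc n) x\<bar> < d"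
      using f_E_diff_Cauchy[OF x u d(1)] by blast
    have "dist (E (Suc n) x) (E (Suc m) x) < r" if "M \<le> n" "n < m" for m n
    proof -
      have "\<bar>E (Suc m) x - E (Suc n) x\<bar> \<le> u + u"
        by (meson E_le abs_triangle_ineq4 add_mono order_trans)
      then show ?thesis
        using d(2) M[of n m] that by (simp add: dist_norm norm_minus_commute)
    qed
    then show "\<exists>M. \<forall>m\<ge>M. \<forall>n>m. dist (E (Suc m) x) (E (Suc n) x) < r" by blast
  qed
  then show ?thesis
    using Cauchy_convergent convergent_Suc_iff[of "\<lambda>n. E n x"] by blast
qed

text \<open>Uniform boundedness of the \<open>E n\<close> allows an \<open>\<epsilon>/3\<close> argument.\<close>

lemma closed_E_convergent: "closed {x. convergent (\<lambda>n. E n x)}"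
proof -
  obtain B where B: "\<And>n. 1 \<le> n \<Longrightarrow> onorm (E n) \<le> B"
    using bounded_filtration by (auto simp: bounded_filtration_def bdd_above_def)
  define K where "K = max B 1"
  have K: "norm (E n z) \<le> K * norm z" if "1 \<le> n" for n z
  proof -
    have "norm (E n z) \<le> onorm (E n) * norm z"
      by (rule onorm[OF E_bounded_linear[OF that]])
    also have "\<dots> \<le> K * norm z"
      using B[OF that] by (intro mult_right_mono) (auto simp: K_def)
    finally show ?thesis .
  qed
  show ?thesis
    unfolding closed_sequential_limits
  proof (intro allI impI, elim conjE)
    fix X x assume X: "\<forall>k. X k \<in> {x. convergent (\<lambda>n. E n x)}" and lim: "X \<longlonglongrightarrow> x"
    have "Cauchy (\<lambda>n. E n x)"
    proof (rule CauchyI)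
      fix r :: real assume r: "0 < r"
      have K0: "0 < K" by (simp add: K_def)
      obtain k where k: "norm (X k - x) < r / (3 * K)"
        using LIMSEQ_D[OF lim, of "r / (3 * K)"] r K0 by auto
      have "Cauchy (\<lambda>n. E n (X k))"
        using X by (intro convergent_Cauchy) simp
      then obtain M where M: "\<And>m n. M \<le> m \<Longrightarrow> M \<le> n \<Longrightarrow> norm (E m (X k) - E n (X k)) < r / 3"
        using CauchyD[of _ "r / 3"] r by (metis divide_pos_pos zero_less_numeral)
      have close: "norm (E n x - E n (X k)) < r / 3" if "1 \<le> n" for n
      proof -
        have "norm (E n x - E n (X k)) = norm (E n (X k - x))"
          by (simp add: linear_diff[OF E_linear[OF that]] norm_minus_commute)
        also have "\<dots> \<le> K * norm (X k - x)"
          by (rule K[OF that])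
        also have "\<dots> < r / 3"
          using k K0 by (simp add: field_simps)
        finally show ?thesis .
      qed
      have "norm (E m x - E n x) < r" if "max M 1 \<le> m" "max M 1 \<le> n" for m n
      proof -
        have "E m x - E n x = (E m x - E m (X k)) + (E m (X k) - E n (X k)) - (E n x - E n (X k))"
          by simp
        then have "norm (E m x - E n x) \<le>
            norm (E m x - E m (X k)) + norm (E m (X k) - E n (X k)) + norm (E n x - E n (X k))"
          by (metis add_right_mono norm_triangle_ineq norm_triangle_ineq4 order_trans)
        then show ?thesis
          using close[of m] close[of n] M[of m n] that by simp
      qed
      then show "\<exists>M. \<forall>m\<ge>M. \<forall>n\<ge>M. norm (E m x - E n x) < r" by blast
    qed
    then show "x \<in> {x. convergent (\<lambda>n. E n x)}"
      by (simp add: Cauchy_convergent)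
  qed
qed

lemma truncations_LIMSEQ:
  assumes "0 \<le> x"
  shows "(\<lambda>n::nat. inf x (real n *\<^sub>R e)) \<longlonglongrightarrow> x"
proof -
  let ?X = "\<lambda>n::nat. inf x (real n *\<^sub>R e)"
  have inc: "incseq ?X" and lub: "isLub UNIV (range ?X) x"
    using weak_unit assms by (auto simp: weak_unit_def)
  have "convergent ?X"
    by (rule incseq_bounded_convergent[OF order_continuous inc, of x]) simp
  then obtain y where y: "?X \<longlonglongrightarrow> y" by (auto simp: convergent_def)
  have "y \<le> x"
    by (rule LIMSEQ_le_banach_lattice[OF y tendsto_const]) simp
  moreover have "x \<le> y"
    using lub incseq_LIMSEQ_upper[OF inc y]
    by (auto simp: isLub_def leastP_def setge_def isUb_def setle_def)
  ultimately show ?thesis using y by simp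
qed

lemma E_convergent: "convergent (\<lambda>n. E n x)"
proof -
  have nonneg: "convergent (\<lambda>n. E n x)" if "0 \<le> x" for x
  proof -
    have "convergent (\<lambda>n. E n (inf x (real k *\<^sub>R e)))" for k
    proof (rule E_convergent_if_dominated)
      show "\<bar>inf x (real k *\<^sub>R e)\<bar> \<le> real k *\<^sub>R e"
        using that e_nonneg by (simp add: scaleR_nonneg_nonneg)
      show "E n (real k *\<^sub>R e) = real k *\<^sub>R e" if "1 \<le> n" for n
        using that by (simp add: linear_scale[OF E_linear] E_e)
    qed
    then have "x \<in> {x. convergent (\<lambda>n. E n x)}"
      by (intro closed_sequentially[OF closed_E_convergent _ truncations_LIMSEQ[OF that]]) simp
    then show ?thesis by simp
  qed
  have "convergent (\<lambda>n. E (Suc n) (pprt x) - E (Suc n) (pprt (- x)))"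
    using nonneg[of "pprt x"] nonneg[of "pprt (- x)"]
    by (intro convergent_diff) (simp_all add: convergent_Suc_iff[of "\<lambda>n. E n _"])
  moreover have "E (Suc n) (pprt x) - E (Suc n) (pprt (- x)) = E (Suc n) x" for n
    using prts[of x] by (simp add: pprt_neg linear_diff[OF E_linear, symmetric])
  ultimately show ?thesis
    using convergent_Suc_iff[of "\<lambda>n. E n x"] by simp
qed

section \<open>A maximal inequality and unbounded order convergence\<close>

text \<open>
  Doob's maximal inequality without indicators. With \<open>Z k = E (k + 1) z\<close>, the lattice polynomial
  \<open>G k = inf (pprt (M k - u)) u\<close> of the running supremum plays the role of the indicator of
  \<open>M k > u\<close>: it vanishes where \<open>M k \<le> u\<close>, it is at most \<open>u\<close>, and it is fixed by \<open>E (k + 1)\<close>.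
  The process \<open>inf u (Z k + G k)\<close> is a supermartingale whose \<open>f\<close>-value is at most \<open>f z\<close> at the
  start, and it dominates \<open>G k\<close>. Updating \<open>G\<close> does not increase it, since \<open>G\<close> only grows where \<open>Z k > u\<close>, and there
  the infimum already equals \<open>u\<close> (the step \<open>absorb\<close>). Updating \<open>Z\<close> with \<open>G\<close> held fixed is
  Jensen's inequality for the concave function \<open>inf u\<close>.
\<close>

lemma lattice_maximal_inequality:
  assumes z: "0 \<le> z" and u: "0 \<le> u" "\<And>n. 1 \<le> n \<Longrightarrow> E n u = u"
  shows "f (inf (pprt (running_sup (\<lambda>i. E (Suc i) z) k - u)) u) \<le> f z"
proof -
  define Z where "Z i = E (Suc i) z" for i
  define g where "g y = inf (pprt (y - u)) u" for y
  define G where "G k = g (running_sup Z k)" for k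
  have Z_nonneg: "0 \<le> Z i" for i
    using z by (simp add: Z_def E_nonneg)
  have g_nonneg: "0 \<le> g y" for y
    using u(1) by (simp add: g_def)
  have absorb: "inf u (y + sup h (g y)) \<le> y + h" if y: "0 \<le> y" and h: "0 \<le> h" for y h
  proof -
    have "inf u (y + g y) = y + inf (u - y) (g y)"
      using add_inf_distrib_left[of y "u - y" "g y"] by simp
    also have "\<dots> \<le> y + inf (pprt (u - y)) (pprt (y - u))"
      by (intro add_left_mono inf_mono le_pprt) (simp add: g_def)
    also have "\<dots> = y"
      using inf_pprt_pprt_minus[of "u - y"] by simp
    finally have *: "inf u (y + g y) \<le> y" .
    have "inf u (y + sup h (g y)) = sup (inf u (y + h)) (inf u (y + g y))"
      by (simp only: add_sup_distrib_left lattice_group_inf_sup_distrib)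
    also have "\<dots> \<le> y + h"
      using order_trans[OF *, of "y + h"] h by (simp add: le_infI2)
    finally show ?thesis .
  qed
  have G_Suc: "G (Suc k) = sup (G k) (g (Z (Suc k)))" for k
    unfolding G_def g_def running_sup.simps pprt_diff_sup
    using lattice_group_inf_sup_distrib[of u] by (simp only: inf_commute)
  have E_G: "E (Suc k) (G k) = G k" for k
  proof -
    have fixed: "positive_operator (E (Suc k))" "\<And>x. f (E (Suc k) x) = f x"
      by (simp_all add: E_positive f_E)
    have E_Z: "E (Suc k) (Z j) = Z j" if "j \<le> k" for j
      using that by (simp add: Z_def E_E)
    have "E (Suc k) (running_sup Z j) = running_sup Z j" if "j \<le> k" for j
      using that
    proof (induction j)
      case 0
      then show ?case by (simp add: E_Z)
    next
      case (Suc j)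
      then show ?case
        using fixed_sup[OF fixed, of "running_sup Z j" "Z (Suc j)"] by (simp add: E_Z)
    qed
    then have "E (Suc k) (running_sup Z k - u) = running_sup Z k - u"
      using u(2)[of "Suc k"] by (simp add: linear_diff[OF E_linear])
    then have "E (Suc k) (pprt (running_sup Z k - u)) = pprt (running_sup Z k - u)"
      unfolding pprt_def by (intro fixed_sup[OF fixed]) (simp_all add: linear_0[OF E_linear])
    then show ?thesis
      unfolding G_def g_def using u(2) by (intro fixed_inf[OF fixed]) simp_all
  qed
  have "f (inf u (Z k + G k)) \<le> f z"
  proof (induction k)
    case 0
    have "inf u (Z 0 + G 0) \<le> Z 0"
      using absorb[OF Z_nonneg, of 0 0] g_nonneg[of "Z 0"] by (simp add: G_def sup_absorb2)
    then have "f (inf u (Z 0 + G 0)) \<le> f (Z 0)"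
      by (rule f_mono)
    then show ?case by (simp add: Z_def f_E)
  next
    case (Suc k)
    let ?W = "inf u (Z (Suc k) + G k)"
    have "inf u (Z (Suc k) + G (Suc k)) \<le> ?W"
      using absorb[OF Z_nonneg g_nonneg] by (simp add: G_Suc) (simp add: G_def)
    then have "f (inf u (Z (Suc k) + G (Suc k))) \<le> f ?W"
      by (rule f_mono)
    also have "\<dots> = f (E (Suc k) ?W)"
      by (simp add: f_E)
    also have "\<dots> \<le> f (inf u (Z k + G k))"
    proof (rule f_mono, rule le_infI)
      show "E (Suc k) ?W \<le> u"
        using E_mono[of "Suc k" ?W u] u(2)[of "Suc k"] by simp
      have "E (Suc k) (Z (Suc k) + G k) = Z k + G k"
        by (simp add: linear_add[OF E_linear] E_G) (simp add: Z_def E_E)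
      then show "E (Suc k) ?W \<le> Z k + G k"
        using E_mono[of "Suc k" ?W "Z (Suc k) + G k"] by simp
    qed
    finally show ?case using Suc by simp
  qed
  moreover have "G k \<le> inf u (Z k + G k)"
    using Z_nonneg by (simp add: G_def g_def)
  ultimately have "f (G k) \<le> f z"
    using f_mono order_trans by blast
  then show ?thesis by (simp add: G_def g_def Z_def[abs_def])
qed

lemma eq_0_if_disjoint_weak_unit:
  assumes y: "0 \<le> y" and c: "0 < c" and disj: "inf y (c *\<^sub>R e) = 0"
  shows "y = 0"
proof -
  have "inf y (real n *\<^sub>R e) \<le> 0" for n
  proof -
    define a where "a = max 1 (real n / c)"
    have "inf y (real n *\<^sub>R e) \<le> inf (a *\<^sub>R y) (a *\<^sub>R c *\<^sub>R e)"
    proof (rule inf_mono)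
      show "y \<le> a *\<^sub>R y"
        using scaleR_right_mono[of 1 a y] y by (simp add: a_def)
      have "real n \<le> a * c"
        using c by (simp add: a_def flip: pos_divide_le_eq)
      then show "real n *\<^sub>R e \<le> a *\<^sub>R c *\<^sub>R e"
        using e_nonneg by (simp add: scaleR_right_mono)
    qed
    also have "\<dots> = a *\<^sub>R inf y (c *\<^sub>R e)"
      by (simp add: scaleR_inf a_def)
    finally show ?thesis by (simp add: disj)
  qed
  then have "y \<le> 0"
    using weak_unit y
    by (auto simp: weak_unit_def isLub_def leastP_def setge_def isUb_def setle_def)
  with y show ?thesis by simp
qed

lemma E_limit:
  assumes lim: "(\<lambda>n. E n x) \<longlonglongrightarrow> l" and m: "1 \<le> m"
  shows "E m l = E m x"
proof (rule LIMSEQ_unique)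
  show "(\<lambda>n. E m (E n x)) \<longlonglongrightarrow> E m l"
    by (rule bounded_linear.tendsto[OF E_bounded_linear[OF m] lim])
  have "\<forall>\<^sub>F n in sequentially. E m (E n x) = E m x"
    using eventually_ge_at_top[of m] by eventually_elim (use m in \<open>simp add: E_E min_absorb2\<close>)
  then show "(\<lambda>n. E m (E n x)) \<longlonglongrightarrow> E m x"
    by (rule tendsto_eventually)
qed

text \<open>
  For \<open>n \<ge> m\<close>, \<open>E n l - l = E n (l - E m l) - (l - E m l)\<close>. The truncation at \<open>w\<close> makes the
  running suprema of the \<open>E n \<bar>l - E m l\<bar>\<close> order bounded, so that their supremum \<open>s\<close> exists as
  a norm limit and inherits the maximal inequality.
\<close>

lemma tail_upper_bound:
  assumes w: "0 \<le> w" and m: "1 \<le> m" and u: "0 \<le> u" "\<And>n. 1 \<le> n \<Longrightarrow> E n u = u"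
  obtains s where "\<And>n. m \<le> n \<Longrightarrow> inf \<bar>E n l - l\<bar> w \<le> \<bar>l - E m l\<bar> + s"
    and "f (inf (pprt (s - u)) u) \<le> f \<bar>l - E m l\<bar>"
proof -
  define z where "z = \<bar>l - E m l\<bar>"
  define M where "M = running_sup (\<lambda>i. E (Suc i) z)"
  have z: "0 \<le> z" by (simp add: z_def)
  have inc: "incseq (\<lambda>k. inf (M k) w)"
    using running_sup_incseq[of "\<lambda>i. E (Suc i) z"]
    by (auto simp: M_def incseq_def intro: le_infI1)
  have "convergent (\<lambda>k. inf (M k) w)"
    by (rule incseq_bounded_convergent[OF order_continuous inc, of w]) simp
  then obtain s where s: "(\<lambda>k. inf (M k) w) \<longlonglongrightarrow> s"
    by (auto simp: convergent_def)
  show thesis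
  proof
    fix n assume n: "m \<le> n"
    then have n1: "1 \<le> n" using m by simp
    have "E n l - l = E n (l - E m l) - (l - E m l)"
      using n m n1 by (simp add: linear_diff[OF E_linear] E_E min_absorb1)
    then have "\<bar>E n l - l\<bar> \<le> \<bar>E n (l - E m l)\<bar> + z"
      unfolding z_def by (metis abs_triangle_ineq4)
    also have "\<dots> \<le> z + E n z"
      using abs_E_le[OF n1, of "l - E m l"] by (simp add: z_def add.commute)
    finally have "inf \<bar>E n l - l\<bar> w \<le> inf (z + E n z) w"
      by (rule inf_mono) simp
    also have "\<dots> \<le> z + inf (E n z) w"
      by (rule inf_add_le[OF z])
    also have "inf (E n z) w \<le> inf (M (n - 1)) w"
      using running_sup_upper[of "n - 1" "n - 1" "\<lambda>i. E (Suc i) z"] n1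
      by (intro inf_mono) (simp_all add: M_def)
    also have "\<dots> \<le> s"
      by (rule incseq_LIMSEQ_upper[OF inc s])
    finally show "inf \<bar>E n l - l\<bar> w \<le> \<bar>l - E m l\<bar> + s"
      by (simp add: z_def)
  next
    have "f (inf (pprt (inf (M k) w - u)) u) \<le> f z" for k
    proof -
      have "inf (pprt (inf (M k) w - u)) u \<le> inf (pprt (M k - u)) u"
        by (intro inf_mono pprt_mono diff_right_mono) simp_all
      then show ?thesis
        using lattice_maximal_inequality[OF z u, of k] f_mono order_trans
        unfolding M_def by blast
    qed
    moreover have "(\<lambda>k. f (inf (pprt (inf (M k) w - u)) u)) \<longlonglongrightarrow> f (inf (pprt (s - u)) u)"
      by (intro tendsto_f tendsto_inf tendsto_pprt tendsto_diff s tendsto_const)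
    ultimately show "f (inf (pprt (s - u)) u) \<le> f \<bar>l - E m l\<bar>"
      unfolding z_def by (intro LIMSEQ_le_const2) auto
  qed
qed

text \<open>
  By the previous lemma \<open>v \<le> z + s\<close> with \<open>z = \<bar>l - E m l\<bar>\<close>, which gives
  \<open>f (inf (pprt (v - u)) u) \<le> 2 f z\<close> for every multiple \<open>u = c e\<close>. Here \<open>f z\<close>
  tends to zero as \<open>m\<close> grows, and the left-hand side is independent of \<open>m\<close>. So it vanishes, and \<open>v \<le> c e\<close> follows for all \<open>c > 0\<close>.
\<close>

lemma eventual_lower_bound_nonpos:
  assumes lim: "(\<lambda>n. E n l) \<longlonglongrightarrow> l" and w: "0 \<le> w"
    and v: "\<And>y m. 1 \<le> m \<Longrightarrow> (\<And>n. m \<le> n \<Longrightarrow> inf \<bar>E n l - l\<bar> w \<le> y) \<Longrightarrow> v \<le> y"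
  shows "v \<le> 0"
proof (rule le_zero_if_le_all_scaled[OF e_nonneg])
  fix c :: real assume c: "0 < c"
  define u where "u = c *\<^sub>R e"
  have u: "0 \<le> u" "\<And>n. 1 \<le> n \<Longrightarrow> E n u = u"
    using c e_nonneg by (simp_all add: u_def scaleR_nonneg_nonneg linear_scale[OF E_linear] E_e)
  let ?h = "inf (pprt (v - u)) u"
  have bound: "f ?h \<le> 2 * f \<bar>l - E m l\<bar>" if m: "1 \<le> m" for m
  proof -
    let ?z = "\<bar>l - E m l\<bar>"
    obtain s where s: "\<And>n. m \<le> n \<Longrightarrow> inf \<bar>E n l - l\<bar> w \<le> ?z + s"
      "f (inf (pprt (s - u)) u) \<le> f ?z"
      using tail_upper_bound[OF w m u] by blast
    have "v \<le> ?z + s" using v[OF m s(1)] by blast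
    then have "v - u \<le> ?z + (s - u)"
      by (simp add: diff_le_eq)
    then have "pprt (v - u) \<le> pprt (?z + (s - u))"
      by (rule pprt_mono)
    also have "\<dots> \<le> ?z + pprt (s - u)"
      using pprt_add_le[of ?z "s - u"] by simp
    finally have "?h \<le> inf (?z + pprt (s - u)) u"
      by (rule inf_mono) simp
    also have "\<dots> \<le> ?z + inf (pprt (s - u)) u"
      by (rule inf_add_le) simp
    finally have "f ?h \<le> f (?z + inf (pprt (s - u)) u)"
      by (rule f_mono)
    with s(2) show ?thesis by (simp add: f_simps)
  qed
  have "(\<lambda>m. 2 * f \<bar>l - E m l\<bar>) \<longlonglongrightarrow> 2 * f 0"
  proof (intro tendsto_mult tendsto_const tendsto_f)
    have "(\<lambda>m. norm \<bar>l - E m l\<bar>) \<longlonglongrightarrow> 0"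
      using tendsto_norm_zero[OF LIM_zero[OF lim]] by (simp add: norm_minus_commute)
    then show "(\<lambda>m. \<bar>l - E m l\<bar>) \<longlonglongrightarrow> 0"
      by (rule tendsto_norm_zero_cancel)
  qed
  then have "f ?h \<le> 2 * f 0"
    by (rule LIMSEQ_le_const) (use bound in blast)
  then have "?h = 0"
    using u(1) by (intro eq_0_if_f_le_0) (simp_all add: f_simps)
  then have "pprt (v - u) = 0"
    unfolding u_def by (rule eq_0_if_disjoint_weak_unit[OF zero_le_pprt c])
  then show "v \<le> c *\<^sub>R e"
    using le_zero_iff_zero_pprt[of "v - u"] by (simp add: u_def)
qed

text \<open>
  The dominating net consists of all eventual upper bounds of \<open>inf \<bar>E n x - l\<bar> w\<close>, directed
  downwards; the previous lemma says that its infimum is zero.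
\<close>

lemma E_uo_convergent:
  assumes lim: "(\<lambda>n. E n x) \<longlonglongrightarrow> l"
  shows "uo_converges_to {1..} (\<le>) (\<lambda>n. E n x) l"
  unfolding uo_converges_to_def
proof (intro allI impI)
  fix w :: 'a assume w: "0 \<le> w"
  have E_l: "E n l = E n x" if "1 \<le> n" for n
    by (rule E_limit[OF lim that])
  then have "\<forall>\<^sub>F n in sequentially. E n x = E n l"
    by (intro eventually_sequentiallyI[of 1]) simp
  with lim have lim_l: "(\<lambda>n. E n l) \<longlonglongrightarrow> l"
    by (rule Lim_transform_eventually)
  define d where "d n = inf \<bar>E n x - l\<bar> w" for n
  define J where "J = {y. \<exists>m\<ge>1. \<forall>n\<ge>m. d n \<le> y}"
  have d_nonneg: "0 \<le> d n" for n using w by (simp add: d_def)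
  have J_nonneg: "0 \<le> y" if "y \<in> J" for y
    using that d_nonneg by (auto simp: J_def intro: order_trans)
  have "\<exists>c\<in>J. c \<le> a \<and> c \<le> b" if "a \<in> J" "b \<in> J" for a b
  proof -
    from that obtain m k where "1 \<le> m" "\<forall>n\<ge>m. d n \<le> a" "\<forall>n\<ge>k. d n \<le> b"
      by (auto simp: J_def)
    then have "inf a b \<in> J"
      unfolding J_def by (intro CollectI exI[of _ "max m k"]) auto
    then show ?thesis by (intro bexI[of _ "inf a b"]) auto
  qed
  moreover have "w \<in> J" by (auto simp: J_def d_def)
  ultimately have "directed_index J (\<ge>)"
    by (auto simp: directed_index_def reflp_on_def transp_on_def)
  moreover have "isGlb UNIV (id ` J) 0"
  proof -
    have "v \<le> 0" if v: "\<And>y. y \<in> J \<Longrightarrow> v \<le> y" for v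
    proof (rule eventual_lower_bound_nonpos[OF lim_l w])
      fix y m assume "1 \<le> m" "\<And>n. m \<le> n \<Longrightarrow> inf \<bar>E n l - l\<bar> w \<le> y"
      then have "y \<in> J"
        using E_l by (auto simp: J_def d_def)
      then show "v \<le> y" by (rule v)
    qed
    then show ?thesis
      using J_nonneg by (auto simp: isGlb_def greatestP_def isLb_def setge_def setle_def)
  qed
  ultimately have "decreases_to_zero J (\<ge>) id"
    by (auto simp: decreases_to_zero_def monotone_on_def)
  then have "order_converges_to {1..} (\<le>) d 0"
  proof (rule order_converges_toI)
    fix y assume "y \<in> J"
    then show "net_eventually {1..} (\<le>) (\<lambda>n. \<bar>d n - 0\<bar> \<le> id y)"
      using d_nonneg by (auto simp: J_def net_eventually_def)
  qed
  then show "order_converges_to {1..} (\<le>) (\<lambda>n. inf \<bar>E n x - l\<bar> w) 0"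
    by (simp add: d_def[abs_def])
qed

end

theorem theorem5p15:
  fixes E :: "nat \<Rightarrow> 'a::banach_lattice \<Rightarrow> 'a"
    and x :: 'a
  assumes "order_continuous_lattice TYPE('a)"
    and "bounded_filtration E"
    and "abstract_bistochastic E"
  shows "\<exists>l. uo_converges_to {1..} (\<le>) (\<lambda>n. E n x) l \<and> (\<lambda>n. E n x) \<longlonglongrightarrow> l"
proof -
  obtain e f where "weak_unit e" "strictly_positive_functional f" "E 1 e = e" "f \<circ> E 1 = f"
    using assms(3) unfolding abstract_bistochastic_def by blast
  then interpret bistochastic_filtration f E e
    using assms(1,2) by unfold_locales
  obtain l where "(\<lambda>n. E n x) \<longlonglongrightarrow> l"
    using E_convergent[of x] by (auto simp: convergent_def)
  then show ?thesis
    using E_uo_convergent by blast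
qed

end
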